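(* Let $X$ be a real Hilbert space. Assume that $L:X\to2^X$ is single-valued, invertible, strictly monotone and maximal monotone. Let $Q:X\to2^X$ be a monotone operator. If $I\subseteq QLQL$ or $I\subseteq LQLQ$, then $Q=L^{-1}$, and hence $Q$ is actually single-valued, invertible, strictly monotone and maximal monotone.
   Context: $2^X$ is the set of all subsets of $X$. A set-valued operator $A:X\to2^X$ is identified with its graph $G(A)=\{(x,y)\in X^2:y\in Ax\}$; $A\subseteq B$ means $G(A)\subseteq G(B)$, i.e. $Ax\subseteq Bx$ for all $x\in X$. $A$ is single-valued if $Ax$ is a singleton for every $x\in X$; it is then regarded as a function $X\to X$, and invertible means that this function is a bijection. Composition: $(BA)(x):=\bigcup_{x'\in Ax}Bx'$. The inverse $A^{-1}$ is the set-valued operator with graph $\{(y,x):y\in Ax\}$. $I$ is the identity operator. $A$ is monotone if $\langle y_2-y_1,x_2-x_1\rangle\ge0$ for all $x_1,x_2\in X$ and all $y_i\in Ax_i$, $i=1,2$; strictly monotone if this inequality is strict whenever $x_1\neq x_2$; maximal monotone if it is monotone and there is no monotone $B:X\to2^X$ with $A\subseteq B$ and $A\neq B$. *)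

theory Defs
  imports "HOL-Analysis.Analysis"
begin

text \<open>
  Set-valued operators on \<open>X\<close> are functions \<open>'a \<Rightarrow> 'a set\<close>. Inclusion of operators (that is,
  of graphs) is the pointwise order \<open>A \<le> B\<close> of the function type.
\<close>

type_synonym 'a setop = "'a \<Rightarrow> 'a set"

definition op_id :: "'a setop" where
  "op_id x = {x}"

definition op_comp :: "'a setop \<Rightarrow> 'a setop \<Rightarrow> 'a setop"  (infixr "\<circ>\<^sub>o" 75) where
  "(B \<circ>\<^sub>o A) x = (\<Union>x'\<in>A x. B x')"

definition op_inverse :: "'a setop \<Rightarrow> 'a setop" where
  "op_inverse A y = {x. y \<in> A x}"

text \<open>Everywhere defined with exactly one value, unlike \<^const>\<open>single_valued\<close> on relations.\<close>

definition op_single_valued :: "'a setop \<Rightarrow> bool" where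
  "op_single_valued A \<longleftrightarrow> (\<forall>x. is_singleton (A x))"

definition op_invertible :: "'a setop \<Rightarrow> bool" where
  "op_invertible A \<longleftrightarrow> op_single_valued A \<and> bij (\<lambda>x. the_elem (A x))"

definition op_monotone :: "'a::real_inner setop \<Rightarrow> bool" where
  "op_monotone A \<longleftrightarrow>
     (\<forall>x1 x2. \<forall>y1\<in>A x1. \<forall>y2\<in>A x2. inner (y2 - y1) (x2 - x1) \<ge> 0)"

definition op_strictly_monotone :: "'a::real_inner setop \<Rightarrow> bool" where
  "op_strictly_monotone A \<longleftrightarrow> op_monotone A \<and>
     (\<forall>x1 x2. x1 \<noteq> x2 \<longrightarrow> (\<forall>y1\<in>A x1. \<forall>y2\<in>A x2. inner (y2 - y1) (x2 - x1) > 0))"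

definition op_maximal_monotone :: "'a::real_inner setop \<Rightarrow> bool" where
  "op_maximal_monotone A \<longleftrightarrow> op_monotone A \<and> \<not> (\<exists>B. op_monotone B \<and> A \<le> B \<and> A \<noteq> B)"

end

theory Submission
  imports Defs
begin

text \<open>
  Either inclusion provides, for every \<open>x\<close>, a point \<open>y\<close> with
  \<open>y \<in> Q (L x)\<close> and \<open>x \<in> Q (L y)\<close>. Monotonicity of \<open>Q\<close> at the pairs \<open>(L x, y)\<close> and \<open>(L y, x)\<close> has
  the opposite sign to strict monotonicity of \<open>L\<close> at \<open>x\<close> and \<open>y\<close>, so \<open>x = y\<close>. Hence \<open>Q\<close> extends
  the inverse of \<open>L\<close>, which is maximal monotone because \<open>L\<close> is.
\<close>

lemma mem_op_comp [simp]: "z \<in> (B \<circ>\<^sub>o A) x \<longleftrightarrow> (\<exists>y\<in>A x. z \<in> B y)"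
  by (simp add: op_comp_def)

lemma mem_op_inverse [simp]: "x \<in> op_inverse A y \<longleftrightarrow> y \<in> A x"
  by (simp add: op_inverse_def)

lemma op_inverse_inverse [simp]: "op_inverse (op_inverse A) = A"
  by (intro ext set_eqI) simp

lemma op_inverse_mono: "A \<le> B \<Longrightarrow> op_inverse A \<le> op_inverse B"
  by (fastforce simp: le_fun_def)

lemma op_monotone_inverse:
  "op_monotone A \<Longrightarrow> op_monotone (op_inverse A)"
  by (metis inner_commute mem_op_inverse op_monotone_def)

lemma op_maximal_monotone_eq:
  "op_maximal_monotone A \<Longrightarrow> op_monotone B \<Longrightarrow> A \<le> B \<Longrightarrow> B = A"
  by (auto simp: op_maximal_monotone_def)

text \<open>Inversion is an involution that preserves both inclusion and monotonicity, so inverting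
  a monotone extension of \<open>op_inverse A\<close> gives a monotone extension of
  \<open>A\<close>, which must be \<open>A\<close> itself.\<close>

lemma op_maximal_monotone_inverse:
  assumes "op_maximal_monotone A"
  shows "op_maximal_monotone (op_inverse A)"
proof -
  have "op_inverse A = B" if "op_monotone B" "op_inverse A \<le> B" for B
  proof -
    have "op_inverse B = A"
      using assms op_monotone_inverse[OF that(1)] op_inverse_mono[OF that(2)]
      by (intro op_maximal_monotone_eq) simp_all
    then show ?thesis by auto
  qed
  with assms show ?thesis
    by (auto simp: op_maximal_monotone_def op_monotone_inverse)
qed

text \<open>Trades \<open>the_elem\<close> for an honest bijection \<open>f\<close>, so that
  membership in \<open>A x\<close> becomes an equation with \<open>f x\<close>.\<close>

lemma op_invertible_altdef:
  "op_invertible A \<longleftrightarrow> (\<exists>f. bij f \<and> A = (\<lambda>x. {f x}))"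
proof
  assume "op_invertible A"
  then have "bij (\<lambda>x. the_elem (A x))" "\<And>x. A x = {the_elem (A x)}"
    by (simp_all add: op_invertible_def op_single_valued_def is_singleton_the_elem)
  then show "\<exists>f. bij f \<and> A = (\<lambda>x. {f x})"
    by (intro exI[of _ "\<lambda>x. the_elem (A x)"]) auto
qed (auto simp: op_invertible_def op_single_valued_def)

lemma op_invertible_inverse:
  assumes "op_invertible A"
  shows "op_invertible (op_inverse A)"
proof -
  obtain f where f: "bij f" "A = (\<lambda>x. {f x})"
    using assms by (auto simp: op_invertible_altdef)
  have "op_inverse A = (\<lambda>y. {inv f y})"
    using f by (intro ext) (auto simp: op_inverse_def bij_is_surj bij_is_inj surj_f_inv_f inv_f_f)
  with f(1) show ?thesis
    using bij_imp_bij_inv op_invertible_altdef by blast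
qed

lemma op_strictly_monotone_inverse:
  assumes "op_single_valued A" "op_strictly_monotone A"
  shows "op_strictly_monotone (op_inverse A)"
proof -
  have "inner (x2 - x1) (y2 - y1) > 0" if "y1 \<in> A x1" "y2 \<in> A x2" "y1 \<noteq> y2" for x1 x2 y1 y2
  proof -
    \<comment> \<open>Strictness of \<open>A\<close> applies only at distinct values
      \<open>y1\<close>, \<open>y2\<close> of the inverse; strictness of the inverse concerns
      distinct \<open>x1\<close>, \<open>x2\<close>. A single-valued \<open>A\<close> cannot take
      both to the same point.\<close>
    have "x1 \<noteq> x2"
      using that assms(1) by (metis op_single_valued_def is_singletonE singletonD)
    with that assms(2) show ?thesis
      by (auto simp: op_strictly_monotone_def inner_commute)
  qed
  with assms(2) show ?thesis
    by (auto simp: op_strictly_monotone_def op_monotone_inverse)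
qed

lemma op_strictly_monotone_swap_eq:
  assumes "op_strictly_monotone L" "op_monotone Q"
    and "u \<in> L x" "v \<in> L y" "y \<in> Q u" "x \<in> Q v"
  shows "x = y"
proof (rule ccontr)
  assume "x \<noteq> y"
  with assms have "inner (v - u) (y - x) > 0"
    by (auto simp: op_strictly_monotone_def)
  moreover have "inner (x - y) (v - u) \<ge> 0"
    using assms by (auto simp: op_monotone_def)
  ultimately show False
    by (simp add: inner_commute algebra_simps)
qed

theorem lemma6p1:
  fixes L Q :: "'a::{real_inner, complete_space} \<Rightarrow> 'a set"
  assumes "op_single_valued L" and "op_invertible L"
    and "op_strictly_monotone L" and "op_maximal_monotone L"
    and "op_monotone Q"
    and "op_id \<le> Q \<circ>\<^sub>o L \<circ>\<^sub>o Q \<circ>\<^sub>o L \<or> op_id \<le> L \<circ>\<^sub>o Q \<circ>\<^sub>o L \<circ>\<^sub>o Q"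
  shows "Q = op_inverse L \<and> op_single_valued Q \<and> op_invertible Q
    \<and> op_strictly_monotone Q \<and> op_maximal_monotone Q"
proof -
  obtain f where f: "bij f" "L = (\<lambda>x. {f x})"
    using assms(2) by (auto simp: op_invertible_altdef)
  have swap: "x = y" if "y \<in> Q (f x)" "x \<in> Q (f y)" for x y
    using that f(2) by (intro op_strictly_monotone_swap_eq[OF assms(3,5), of "f x" x "f y" y]) simp_all
  \<comment> \<open>The pairs \<open>(f x, x)\<close> make up the graph of
    \<open>op_inverse L\<close>.\<close>
  have "x \<in> Q (f x)" for x
    using assms(6)
  proof
    assume "op_id \<le> Q \<circ>\<^sub>o L \<circ>\<^sub>o Q \<circ>\<^sub>o L"
    then have "x \<in> (Q \<circ>\<^sub>o L \<circ>\<^sub>o Q \<circ>\<^sub>o L) x"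
      by (auto simp: le_fun_def op_id_def)
    then obtain y where "y \<in> Q (f x)" "x \<in> Q (f y)"
      using f(2) by auto
    with swap show ?thesis by blast
  next
    assume "op_id \<le> L \<circ>\<^sub>o Q \<circ>\<^sub>o L \<circ>\<^sub>o Q"
    \<comment> \<open>Here the inclusion is evaluated at \<open>f x\<close> instead of
      \<open>x\<close>: the chain then starts with \<open>Q (f x)\<close>, and the outermost
      \<open>L\<close> is cancelled by injectivity of \<open>f\<close>.\<close>
    then have "f x \<in> (L \<circ>\<^sub>o Q \<circ>\<^sub>o L \<circ>\<^sub>o Q) (f x)"
      by (auto simp: le_fun_def op_id_def)
    then obtain y z where "y \<in> Q (f x)" "z \<in> Q (f y)" "f x = f z"
      using f(2) by auto
    moreover from this have "z = x"
      using f(1) by (auto dest: bij_is_inj injD)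
    ultimately show ?thesis using swap by blast
  qed
  then have "op_inverse L \<le> Q"
    using f(2) by (auto simp: le_fun_def)
  then have "Q = op_inverse L"
    using assms(4,5) by (intro op_maximal_monotone_eq op_maximal_monotone_inverse)
  moreover have "op_invertible (op_inverse L)"
    using assms(2) by (rule op_invertible_inverse)
  ultimately show ?thesis
    using assms by (simp add: op_invertible_def op_strictly_monotone_inverse
        op_maximal_monotone_inverse)
qed

end
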